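(* Let $d\ge2$ and let $\Omega\subset\mathbb{R}^d$ be an open, bounded, connected set containing the origin. There exists a constant $C>0$ (depending only on $\Omega$) such that, for any $N\ge1$, any $k\ge1$ and any $i_1,\dots,i_k\in\{1,\dots,d\}$, for any $x\in\Omega_N$ with $d(x,\partial\Omega_N)\ge4k$ and any $2k\le R\le\frac12\,d(x,\partial\Omega_N)$, we have $$|D_{i_1,\dots,i_k}\phi_N(x)|\le\Big(\frac{Ck}{R}\Big)^k\sup_{w\in B(x,R)}|\phi_N(w)|.$$
   Context: For $N\ge1$, $\Omega_N$ is the connected component of $0$ in $(N\Omega)\cap\mathbb{Z}^d$ (nearest-neighbour graph), and $\partial\Omega_N=\{x\in\mathbb{Z}^d\setminus\Omega_N:\exists y\in\Omega_N,\ y\sim x\}$, where $x\sim y$ means $|x-y|_1=1$. $P_N(x,y)=\frac1{2d}$ if $x\sim y$, $x,y\in\Omega_N$, and $0$ otherwise. $\lambda_N$ is the principal (largest) eigenvalue of $P_N$ and $\phi_N$ the associated eigenvector, positive on $\Omega_N$, normalised by $\frac1{N^d}\sum_{x\in\Omega_N}\phi_N(x)^2=1$, and set equal to $0$ outside $\Omega_N$. $d(x,\partial\Omega_N)=\min_{y\in\partial\Omega_N}|x-y|_1$ is the graph distance on $\mathbb{Z}^d$ from $x$ to $\partial\Omega_N$, and $B(x,R)=\{w\in\mathbb{Z}^d:|w-x|\le R\}$ is the discrete Euclidean ball ($|\cdot|$ the Euclidean norm). For $\psi:\mathbb{Z}^d\to\mathbb{R}$ and $e_i$ the $i$-th canonical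 basis vector, $D_i\psi(x)=\frac12(\psi(x+e_i)-\psi(x-e_i))$ and $D_{i_1,\dots,i_k}=D_{i_1}\cdots D_{i_k}$. *)

theory Defs
  imports "HOL-Analysis.Analysis"
begin

text \<open>Points of the lattice \<open>\<int>\<^sup>d\<close> have type \<^typ>\<open>int ^ 'd\<close>, with \<open>d = CARD('d)\<close>;
  \<open>lat\<close> is the inclusion of the lattice into \<open>\<real>\<^sup>d\<close>.\<close>

definition lat :: "int ^ 'd \<Rightarrow> real ^ 'd" where
  "lat x = (\<chi> i. real_of_int (x $ i))"

definition l1norm :: "int ^ 'd \<Rightarrow> nat" where
  "l1norm x = (\<Sum>i\<in>UNIV. nat \<bar>x $ i\<bar>)"

definition nbr :: "int ^ 'd \<Rightarrow> int ^ 'd \<Rightarrow> bool" where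
  "nbr x y \<longleftrightarrow> l1norm (x - y) = 1"

definition scaled_lattice :: "(real ^ 'd) set \<Rightarrow> nat \<Rightarrow> (int ^ 'd) set" where
  "scaled_lattice \<Omega> N = {x. lat x \<in> (\<lambda>v. real N *\<^sub>R v) ` \<Omega>}"

text \<open>The connected component of the origin: the points joined to \<open>0\<close> by a nearest-neighbour
  path staying in \<open>N\<Omega> \<inter> \<int>\<^sup>d\<close>.\<close>

definition Omega_N :: "(real ^ 'd) set \<Rightarrow> nat \<Rightarrow> (int ^ 'd) set" where
  "Omega_N \<Omega> N = {x \<in> scaled_lattice \<Omega> N.
     (\<lambda>u v. u \<in> scaled_lattice \<Omega> N \<and> v \<in> scaled_lattice \<Omega> N \<and> nbr u v)\<^sup>*\<^sup>* 0 x}"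

definition bdry_N :: "(real ^ 'd) set \<Rightarrow> nat \<Rightarrow> (int ^ 'd) set" where
  "bdry_N \<Omega> N = {x. x \<notin> Omega_N \<Omega> N \<and> (\<exists>y\<in>Omega_N \<Omega> N. nbr y x)}"

definition P_N :: "(real ^ 'd) set \<Rightarrow> nat \<Rightarrow> int ^ 'd \<Rightarrow> int ^ 'd \<Rightarrow> real" where
  "P_N \<Omega> N x y = (if nbr x y \<and> x \<in> Omega_N \<Omega> N \<and> y \<in> Omega_N \<Omega> N
     then 1 / (2 * real CARD('d)) else 0)"

text \<open>\<open>P_N\<close> is viewed as a real symmetric matrix indexed by the finite set \<open>Omega_N \<Omega> N\<close> (so its
  eigenvalues are all real); only the values of \<open>f\<close> on \<open>Omega_N \<Omega> N\<close> matter here.\<close>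

definition eigenvector_P_N :: "(real ^ 'd) set \<Rightarrow> nat \<Rightarrow> real \<Rightarrow> (int ^ 'd \<Rightarrow> real) \<Rightarrow> bool" where
  "eigenvector_P_N \<Omega> N \<mu> f \<longleftrightarrow> (\<exists>x\<in>Omega_N \<Omega> N. f x \<noteq> 0) \<and>
     (\<forall>x\<in>Omega_N \<Omega> N. (\<Sum>y\<in>Omega_N \<Omega> N. P_N \<Omega> N x y * f y) = \<mu> * f x)"

definition eigenvalue_P_N :: "(real ^ 'd) set \<Rightarrow> nat \<Rightarrow> real \<Rightarrow> bool" where
  "eigenvalue_P_N \<Omega> N \<mu> \<longleftrightarrow> (\<exists>f. eigenvector_P_N \<Omega> N \<mu> f)"

definition principal_eigenvalue :: "(real ^ 'd) set \<Rightarrow> nat \<Rightarrow> real \<Rightarrow> bool" where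
  "principal_eigenvalue \<Omega> N l \<longleftrightarrow>
     eigenvalue_P_N \<Omega> N l \<and> (\<forall>\<mu>. eigenvalue_P_N \<Omega> N \<mu> \<longrightarrow> \<mu> \<le> l)"

text \<open>By Perron-Frobenius, for bounded \<open>\<Omega>\<close> containing \<open>0\<close> and \<open>N \<ge> 1\<close>, exactly one \<open>\<phi>\<close>
  satisfies the following predicate.\<close>

definition principal_eigenfunction :: "(real ^ 'd) set \<Rightarrow> nat \<Rightarrow> (int ^ 'd \<Rightarrow> real) \<Rightarrow> bool" where
  "principal_eigenfunction \<Omega> N \<phi> \<longleftrightarrow>
     (\<exists>l. principal_eigenvalue \<Omega> N l \<and> eigenvector_P_N \<Omega> N l \<phi>) \<and>
     (\<forall>x\<in>Omega_N \<Omega> N. \<phi> x > 0) \<and>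
     (\<forall>x. x \<notin> Omega_N \<Omega> N \<longrightarrow> \<phi> x = 0) \<and>
     1 / real N ^ CARD('d) * (\<Sum>x\<in>Omega_N \<Omega> N. (\<phi> x)\<^sup>2) = 1"

text \<open>The infimum is taken in \<^typ>\<open>nat\<close>, so it is attained whenever \<open>A\<close> is nonempty
  (and is \<open>0\<close> for \<open>A = {}\<close>).\<close>

definition graph_dist :: "int ^ 'd \<Rightarrow> (int ^ 'd) set \<Rightarrow> nat" where
  "graph_dist x A = (INF y\<in>A. l1norm (x - y))"

definition discrete_ball :: "int ^ 'd \<Rightarrow> real \<Rightarrow> (int ^ 'd) set" where
  "discrete_ball x R = {w. norm (lat (w - x)) \<le> R}"

definition D :: "'d \<Rightarrow> (int ^ 'd \<Rightarrow> real) \<Rightarrow> int ^ 'd \<Rightarrow> real" where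
  "D i \<psi> x = (\<psi> (x + axis i 1) - \<psi> (x - axis i 1)) / 2"

definition D_iter :: "'d list \<Rightarrow> (int ^ 'd \<Rightarrow> real) \<Rightarrow> int ^ 'd \<Rightarrow> real" where
  "D_iter js \<psi> = foldr D js \<psi>"

end

theory Submission
  imports Defs
begin

text \<open>If \<open>\<Delta> \<psi> = - \<kappa> \<psi>\<close> on an \<open>l\<^sup>1\<close>-ball of radius \<open>n\<close> and \<open>\<kappa> n\<^sup>2\<close> is bounded, an odd reflection and the
  maximum principle with a quadratic barrier give \<open>\<bar>D j \<psi>\<bar> \<le> (c / n) sup \<bar>\<psi>\<bar>\<close> at the centre.
  Discrete derivatives of \<open>\<psi>\<close> solve the same equation, so this can be iterated \<open>k\<close> times with
  steps of length \<open>n = \<lfloor>R / k\<rfloor>\<close>. For \<open>\<phi>\<^sub>N\<close> one has \<open>\<kappa> = 2d (1 - \<lambda>\<^sub>N)\<close>, and \<open>1 - \<lambda>\<^sub>N = O(n\<^sup>-\<^sup>2)\<close>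
  because a cube of side comparable to \<open>n\<close> fits into \<open>Omega_N\<close>. Working with \<open>l\<^sup>1\<close>-balls keeps everything
  inside \<open>Omega_N\<close>, whereas the Euclidean ball of radius \<open>R\<close> may leave it when \<open>d > 4\<close>.\<close>

definition lap :: "(int ^ 'd \<Rightarrow> real) \<Rightarrow> int ^ 'd \<Rightarrow> real" where
  "lap f x = (\<Sum>i\<in>UNIV. f (x + axis i 1) + f (x - axis i 1) - 2 * f x)"

section \<open>The \<open>l1norm\<close> on the lattice and finiteness of its balls\<close>

lemma axis_nth_if: "axis i (c::'a::zero) $ k = (if k = i then c else 0)"
  by (simp add: axis_def)

lemma l1norm_zero [simp]: "l1norm 0 = 0"
  by (simp add: l1norm_def)

lemma l1norm_minus [simp]: "l1norm (- x) = l1norm x"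
  by (simp add: l1norm_def)

lemma l1norm_minus_commute: "l1norm (x - y) = l1norm (y - x)"
  by (simp add: l1norm_def abs_minus_commute)

lemma l1norm_triangle: "l1norm (x + y) \<le> l1norm x + l1norm y"
  unfolding l1norm_def sum.distrib[symmetric] by (rule sum_mono) simp

lemma l1norm_axis: "l1norm (axis i c) = nat \<bar>c\<bar>"
proof -
  have "nat \<bar>axis i c $ k\<bar> = (if k = i then nat \<bar>c\<bar> else 0)" for k
    by (simp add: axis_nth_if)
  then show ?thesis by (simp add: l1norm_def)
qed

lemma l1norm_axis_step: "l1norm (y + axis i 1) \<le> l1norm y + 1" "l1norm (y - axis i 1) \<le> l1norm y + 1"
  using l1norm_triangle[of y "axis i 1"] l1norm_triangle[of y "- axis i 1"]
  by (simp_all add: l1norm_axis)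

lemma nth_le_l1norm: "\<bar>x $ i\<bar> \<le> int (l1norm x)"
proof -
  have "nat \<bar>x $ i\<bar> \<le> l1norm x"
    unfolding l1norm_def by (rule member_le_sum) auto
  then show ?thesis by linarith
qed

lemma l1norm_eq_0: "l1norm x = 0 \<longleftrightarrow> x = 0"
  by (auto simp: l1norm_def vec_eq_iff)

lemma l1norm_eq_nth_plus: "l1norm x = nat \<bar>x $ i\<bar> + (\<Sum>k\<in>UNIV - {i}. nat \<bar>x $ k\<bar>)"
  unfolding l1norm_def by (rule sum.remove) auto

lemma norm_lat_le_l1norm: "norm (lat x) \<le> real (l1norm x)"
proof -
  have "norm (lat x) \<le> (\<Sum>i\<in>UNIV. \<bar>lat x $ i\<bar>)" by (rule norm_le_l1_cart)
  also have "\<dots> = real (l1norm x)" by (simp add: l1norm_def lat_def)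
  finally show ?thesis .
qed

text \<open>Cauchy-Schwarz. The balls used below are \<open>l1norm\<close> balls while the barrier
  is a Euclidean quadratic; comparing the two costs the factor \<open>CARD('d)\<close>.\<close>

lemma l1norm_squared_le:
  "(real (l1norm (x :: int ^ 'd)))\<^sup>2 \<le> real CARD('d) * (\<Sum>i\<in>UNIV. (real_of_int (x $ i))\<^sup>2)"
proof -
  have "(\<Sum>i\<in>UNIV. \<bar>real_of_int (x $ i)\<bar>)\<^sup>2 \<le> real CARD('d) * (\<Sum>i\<in>UNIV. \<bar>real_of_int (x $ i)\<bar>\<^sup>2)"
    using sum_squared_le_sum_of_squares[of "\<lambda>i. \<bar>real_of_int (x $ i)\<bar>" UNIV] by (simp add: mult.commute)
  then show ?thesis by (simp add: l1norm_def)
qed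

lemma finite_int_vec_box:
  assumes "finite A" shows "finite {x :: int ^ 'd. \<forall>i. x $ i \<in> A}"
proof -
  have "x \<in> vec_lambda ` (\<Pi>\<^sub>E i\<in>UNIV. A)" if "\<forall>i. x $ i \<in> A" for x :: "int ^ 'd"
    by (rule image_eqI[of _ _ "\<lambda>i. x $ i"]) (use that in auto)
  then have "{x :: int ^ 'd. \<forall>i. x $ i \<in> A} \<subseteq> vec_lambda ` (\<Pi>\<^sub>E i\<in>UNIV. A)"
    by blast
  then show ?thesis
    by (rule finite_subset) (simp add: finite_PiE assms)
qed

lemma finite_l1_ball: "finite {x :: int ^ 'd. l1norm x \<le> n}"
proof (rule finite_subset)
  show "{x :: int ^ 'd. l1norm x \<le> n} \<subseteq> {x. \<forall>i. x $ i \<in> {- int n..int n}}"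
  proof safe
    fix x :: "int ^ 'd" and i assume "l1norm x \<le> n"
    then show "x $ i \<in> {- int n..int n}" using nth_le_l1norm[of x i] by auto
  qed
qed (rule finite_int_vec_box, simp)

section \<open>Calculus of the discrete Laplacian\<close>

lemma lap_diff: "lap (\<lambda>y. f y - g y) x = lap f x - lap g x"
  by (simp add: lap_def sum_subtractf[symmetric] algebra_simps)

lemma lap_cmult: "lap (\<lambda>y. c * f y) x = c * lap f x"
  by (simp add: lap_def sum_distrib_left algebra_simps)

lemma lap_add: "lap (\<lambda>y. f y + g y) x = lap f x + lap g x"
  by (simp add: lap_def sum.distrib[symmetric] algebra_simps)

lemma lap_uminus: "lap (\<lambda>y. - f y) x = - lap f x"
  using lap_cmult[of "-1" f x] by simp

lemma lap_shift: "lap (\<lambda>y. f (a + y)) x = lap f (a + x)"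
  by (simp add: lap_def add.assoc add_diff_eq)

text \<open>Each axis contributes \<open>(t + 1)^2 + (t - 1)^2 - 2 t^2 = 2\<close>. Together with
  \<open>lap_parabola\<close> this evaluates \<open>lap\<close> on the barrier of the gradient
  estimate.\<close>

lemma lap_sum_squares:
  "lap (\<lambda>y :: int ^ 'd. \<Sum>k\<in>UNIV. (real_of_int (y $ k))\<^sup>2) x = 2 * real CARD('d)"
proof -
  have p: "(\<Sum>k\<in>UNIV. (real_of_int ((x + axis i 1) $ k))\<^sup>2)
      = (\<Sum>k\<in>UNIV. (real_of_int (x $ k))\<^sup>2) + (2 * real_of_int (x $ i) + 1)" for i
  proof -
    have "(\<Sum>k\<in>UNIV. (real_of_int ((x + axis i 1) $ k))\<^sup>2)
      = (\<Sum>k\<in>UNIV. (real_of_int (x $ k))\<^sup>2 + (if k = i then 2 * real_of_int (x $ k) + 1 else 0))"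
      by (rule sum.cong) (auto simp: axis_nth_if power2_eq_square algebra_simps)
    then show ?thesis by (simp add: sum.distrib)
  qed
  have m: "(\<Sum>k\<in>UNIV. (real_of_int ((x - axis i 1) $ k))\<^sup>2)
      = (\<Sum>k\<in>UNIV. (real_of_int (x $ k))\<^sup>2) + (1 - 2 * real_of_int (x $ i))" for i
  proof -
    have "(\<Sum>k\<in>UNIV. (real_of_int ((x - axis i 1) $ k))\<^sup>2)
      = (\<Sum>k\<in>UNIV. (real_of_int (x $ k))\<^sup>2 + (if k = i then 1 - 2 * real_of_int (x $ k) else 0))"
      by (rule sum.cong) (auto simp: axis_nth_if power2_eq_square algebra_simps)
    then show ?thesis by (simp add: sum.distrib)
  qed
  show ?thesis unfolding lap_def p m by simp
qed

lemma lap_parabola: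
  "lap (\<lambda>y :: int ^ 'd. real_of_int (y $ j) * (c - real_of_int (y $ j))) x = -2"
proof -
  have "lap (\<lambda>y :: int ^ 'd. real_of_int (y $ j) * (c - real_of_int (y $ j))) x
     = (\<Sum>i\<in>UNIV. if i = j then - 2 else 0)"
    unfolding lap_def by (rule sum.cong) (auto simp: axis_nth_if algebra_simps)
  then show ?thesis by simp
qed

section \<open>Minimum principle and gradient estimate by odd reflection\<close>

lemma minimum_principle:
  assumes "finite Q" "S \<subseteq> Q"
    and nb: "\<And>y i. y \<in> S \<Longrightarrow> y + axis i 1 \<in> Q \<and> y - axis i 1 \<in> Q"
    and neg: "\<And>y. y \<in> S \<Longrightarrow> lap f y < 0"
    and bd: "\<And>y. y \<in> Q - S \<Longrightarrow> 0 \<le> f y"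
    and "z \<in> Q"
  shows "0 \<le> f z"
proof -
  obtain y where y: "y \<in> Q" "\<And>v. v \<in> Q \<Longrightarrow> f y \<le> f v"
    using ex_is_arg_min_if_finite[of Q f] assms(1,6) by (auto simp: is_arg_min_linorder)
  have "y \<notin> S"
  proof
    assume S: "y \<in> S"
    \<comment> \<open>At a minimum over \<open>Q\<close> every second difference is nonnegative,
      since both neighbours still lie in \<open>Q\<close>; this contradicts the strict inequality on
      \<open>S\<close>.\<close>
    have "0 \<le> lap f y"
      unfolding lap_def
    proof (rule sum_nonneg)
      fix i show "0 \<le> f (y + axis i 1) + f (y - axis i 1) - 2 * f y"
        using y(2)[of "y + axis i 1"] y(2)[of "y - axis i 1"] nb[OF S, of i] by linarith
    qed
    with neg[OF S] show False by simp
  qed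
  with bd y assms(6) show ?thesis by force
qed

definition reflect :: "'d \<Rightarrow> int ^ 'd \<Rightarrow> int ^ 'd" where
  "reflect j x = (\<chi> k. if k = j then - (x $ k) else x $ k)"

lemma l1norm_reflect [simp]: "l1norm (reflect j x) = l1norm x"
  unfolding l1norm_def reflect_def by (rule sum.cong) auto

text \<open>Reflection swaps the two neighbours in direction \<open>j\<close> and commutes with the
  other unit steps, and \<open>lap\<close> is symmetric in each pair of neighbours. Hence the odd
  part of a solution on a centred ball solves the same equation.\<close>

lemma lap_reflect: "lap (\<lambda>y. f (reflect j y)) x = lap f (reflect j x)"
proof -
  have "reflect j (x + axis i 1) = reflect j x + (if i = j then - axis i 1 else axis i 1)"
    and "reflect j (x - axis i 1) = reflect j x - (if i = j then - axis i 1 else axis i 1)" for i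
    by (auto simp: reflect_def vec_eq_iff axis_nth_if)
  then show ?thesis unfolding lap_def by (intro sum.cong) auto
qed

text \<open>The odd part \<open>u\<close> of \<open>\<psi>\<close> in direction \<open>j\<close> vanishes on the hyperplane \<open>y\<^sub>j = 0\<close> and satisfies
  \<open>u e\<^sub>j = D j \<psi> 0\<close>. It is dominated on the half ball \<open>y\<^sub>j \<ge> 0\<close> by a quadratic barrier that is at
  least \<open>M\<close> on the sphere and grows only like \<open>y\<^sub>j * M / n\<close> along the axis.\<close>

lemma gradient_upper_at_0:
  fixes \<psi> :: "int ^ 'd \<Rightarrow> real"
  assumes n: "n \<ge> 1" and M: "M > 0" and kap: "\<kappa> \<ge> 0"
    and le: "\<And>y. l1norm y \<le> n \<Longrightarrow> \<bar>\<psi> y\<bar> \<le> M"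
    and eq: "\<And>y. l1norm y < n \<Longrightarrow> lap \<psi> y = - \<kappa> * \<psi> y"
  shows "D j \<psi> 0 \<le> real CARD('d) * (real CARD('d) + 1) * M / n + \<kappa> * M * n / 2"
proof -
  let ?d = "real CARD('d)"
  define u where "u y = (1/2) * (\<psi> y - \<psi> (reflect j y))" for y
  \<comment> \<open>\<open>a\<close> makes the quadratic term of \<open>w\<close> at least
    \<open>M\<close> on the sphere \<open>l1norm y = n\<close>, by
    \<open>l1norm_squared_le\<close>.\<close>
  define a where "a = M * ?d / n\<^sup>2"
  \<comment> \<open>\<open>b\<close> is tuned so that \<open>lap w = - 2 a - \<kappa> M\<close>: the
    term \<open>\<kappa> M\<close> absorbs \<open>\<kappa> u\<close>, and \<open>2 a\<close> makes
    the inequality strict.\<close>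
  define b where "b = ?d * a + a + \<kappa> * M / 2"
  define w where "w y = a * (\<Sum>k\<in>UNIV. (real_of_int (y $ k))\<^sup>2)
      + b * (real_of_int (y $ j) * (n - real_of_int (y $ j)))" for y :: "int ^ 'd"
  define Q where "Q = {y :: int ^ 'd. l1norm y \<le> n \<and> 0 \<le> y $ j}"
  \<comment> \<open>\<open>Q - S\<close> consists of the flat face \<open>y $ j = 0\<close>, where
    \<open>u = 0\<close>, and the spherical face, where
    \<open>\<bar>u\<bar> \<le> M\<close>.\<close>
  define S where "S = {y :: int ^ 'd. l1norm y < n \<and> 0 < y $ j}"
  have a: "a > 0" using n M by (simp add: a_def)
  have ab: "a \<le> b" using a kap M by (simp add: b_def)
  have ule: "\<bar>u y\<bar> \<le> M" if "l1norm y \<le> n" for y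
    using le[OF that] le[of "reflect j y"] that unfolding u_def by (simp add: abs_le_iff)
  have ulap: "lap u y = - \<kappa> * u y" if "l1norm y < n" for y
    unfolding u_def lap_cmult lap_diff lap_reflect using eq[OF that] eq[of "reflect j y"] that
    by (simp add: algebra_simps)
  have wlap: "lap w y = -2 * a - \<kappa> * M" for y
    unfolding w_def lap_add lap_cmult lap_sum_squares lap_parabola
    by (simp add: b_def algebra_simps)
  have "0 \<le> w (axis j 1) - u (axis j 1)"
  proof (rule minimum_principle[where Q = Q and S = S and f = "\<lambda>y. w y - u y"])
    show "finite Q" unfolding Q_def by (rule finite_subset[OF _ finite_l1_ball[of n]]) auto
    show "S \<subseteq> Q" by (auto simp: S_def Q_def)
    show "y + axis i 1 \<in> Q \<and> y - axis i 1 \<in> Q" if "y \<in> S" for y i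
      using that l1norm_axis_step[of y i] by (auto simp: S_def Q_def axis_nth_if)
    show "lap (\<lambda>y. w y - u y) y < 0" if "y \<in> S" for y
    proof -
      have y: "l1norm y < n" using that by (simp add: S_def)
      have "\<kappa> * u y \<le> \<kappa> * M"
        using ule[of y] y kap by (intro mult_left_mono) auto
      with a ulap[OF y] show ?thesis by (simp add: lap_diff wlap)
    qed
    show "axis j 1 \<in> Q" using n by (simp add: Q_def l1norm_axis axis_nth_if)
    fix y assume y: "y \<in> Q - S"
    have yn: "l1norm y \<le> n" and "0 \<le> y $ j" using y by (auto simp: Q_def)
    have s: "0 \<le> b * (real_of_int (y $ j) * (n - real_of_int (y $ j)))"
      using nth_le_l1norm[of y j] yn \<open>0 \<le> y $ j\<close> a ab by (intro mult_nonneg_nonneg) auto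
    consider "y $ j = 0" | "l1norm y = n" using y by (fastforce simp: Q_def S_def)
    then show "0 \<le> w y - u y"
    proof cases
      case 1
      then have "reflect j y = y" by (simp add: reflect_def vec_eq_iff)
      moreover have "0 \<le> a * (\<Sum>k\<in>UNIV. (real_of_int (y $ k))\<^sup>2)"
        using a by (intro mult_nonneg_nonneg sum_nonneg) auto
      ultimately show ?thesis using s by (simp add: w_def u_def)
    next
      case 2
      have "M = M / n\<^sup>2 * (real n)\<^sup>2" using n by simp
      also have "\<dots> \<le> M / n\<^sup>2 * (?d * (\<Sum>k\<in>UNIV. (real_of_int (y $ k))\<^sup>2))"
        using l1norm_squared_le[of y] 2 M by (intro mult_left_mono) auto
      also have "\<dots> = a * (\<Sum>k\<in>UNIV. (real_of_int (y $ k))\<^sup>2)" by (simp add: a_def)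
      finally show ?thesis using s ule[OF yn] by (simp add: w_def)
    qed
  qed
  moreover have "u (axis j 1) = D j \<psi> 0"
  proof -
    have "reflect j (axis j 1) = - axis j 1"
      by (auto simp: reflect_def vec_eq_iff axis_nth_if)
    then show ?thesis by (simp add: u_def D_def)
  qed
  moreover have "w (axis j 1) = a + b * (real n - 1)"
  proof -
    have "(\<Sum>k\<in>UNIV. (real_of_int (axis j 1 $ k))\<^sup>2) = (\<Sum>k\<in>UNIV. if k = j then 1 else 0)"
      by (rule sum.cong) (auto simp: axis_nth_if)
    then show ?thesis by (simp add: w_def axis_nth_if)
  qed
  ultimately have "D j \<psi> 0 \<le> a + b * (real n - 1)" by simp
  also have "\<dots> \<le> b * n" using ab by (simp add: algebra_simps)
  also have "\<dots> = ?d * (?d + 1) * M / n + \<kappa> * M * n / 2"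
    using n by (simp add: b_def a_def field_simps power2_eq_square)
  finally show ?thesis .
qed

text \<open>A translation moves the centre to \<open>x\<close>; the one-sided estimate applied to
  both \<open>\<psi>\<close> and \<open>- \<psi>\<close> gives the absolute value.\<close>

lemma gradient_bound:
  fixes \<psi> :: "int ^ 'd \<Rightarrow> real"
  assumes n: "n \<ge> 1" and M: "M > 0" and kap: "\<kappa> \<ge> 0"
    and le: "\<And>y. l1norm (y - x) \<le> n \<Longrightarrow> \<bar>\<psi> y\<bar> \<le> M"
    and eq: "\<And>y. l1norm (y - x) < n \<Longrightarrow> lap \<psi> y = - \<kappa> * \<psi> y"
  shows "\<bar>D j \<psi> x\<bar> \<le> real CARD('d) * (real CARD('d) + 1) * M / n + \<kappa> * M * n / 2"
proof -
  have "D j (\<lambda>y. \<psi> (x + y)) 0 \<le> real CARD('d) * (real CARD('d) + 1) * M / n + \<kappa> * M * n / 2"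
    by (rule gradient_upper_at_0) (use assms in \<open>auto simp: lap_shift\<close>)
  moreover have "D j (\<lambda>y. - \<psi> (x + y)) 0 \<le> real CARD('d) * (real CARD('d) + 1) * M / n + \<kappa> * M * n / 2"
    by (rule gradient_upper_at_0) (use assms in \<open>auto simp: lap_shift lap_uminus\<close>)
  moreover have "D j (\<lambda>y. \<psi> (x + y)) 0 = D j \<psi> x" "D j (\<lambda>y. - \<psi> (x + y)) 0 = - D j \<psi> x"
    by (simp_all add: D_def field_simps)
  ultimately show ?thesis by linarith
qed

section \<open>Iterated discrete derivatives\<close>

lemma lap_D: "lap (D j f) x = D j (lap f) x"
proof -
  \<comment> \<open>Written as a combination of two translates, \<open>D j f\<close> passes through
    \<open>lap\<close> by linearity and \<open>lap_shift\<close>.\<close>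
  have "D j f = (\<lambda>y. (1/2) * (f (axis j 1 + y) - f (- axis j 1 + y)))"
    by (auto simp: D_def add.commute)
  then have "lap (D j f) x = (1/2) * (lap f (axis j 1 + x) - lap f (- axis j 1 + x))"
    by (simp only: lap_cmult lap_diff lap_shift)
  then show ?thesis by (simp add: D_def add.commute)
qed

lemma D_iter_Cons [simp]: "D_iter (j # js) f = D j (D_iter js f)"
  by (simp add: D_iter_def)

lemma D_iter_Nil [simp]: "D_iter [] f = f"
  by (simp add: D_iter_def)

text \<open>Every derivative looks one lattice step further, so the radius on which the equation for
  \<open>f\<close> is used grows by one per entry of \<open>js\<close>.\<close>

lemma lap_D_iter_eq:
  assumes "\<And>y. l1norm (y - x) \<le> length js \<Longrightarrow> lap f y = c * f y"
  shows "lap (D_iter js f) x = c * D_iter js f x"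
  using assms
proof (induction js arbitrary: x)
  case Nil
  then show ?case by simp
next
  case (Cons j js)
  have "lap (D_iter js f) z = c * D_iter js f z" if "l1norm (z - x) \<le> 1" for z
  proof (rule Cons.IH)
    fix y assume "l1norm (y - z) \<le> length js"
    then show "lap f y = c * f y"
      using that l1norm_triangle[of "y - z" "z - x"] by (intro Cons.prems) simp
  qed
  from this[of "x + axis j 1"] this[of "x - axis j 1"] show ?case
    by (simp add: lap_D l1norm_axis) (simp add: D_def algebra_simps)
qed

text \<open>Each derivative spends one ball of radius \<open>n\<close> around the current point and
  yields one factor; the nested balls fill radius \<open>length js * n\<close>.\<close>

lemma D_iter_bound:
  fixes f :: "int ^ 'd \<Rightarrow> real"
  assumes n: "n \<ge> 1" and M: "M > 0" and kap: "\<kappa> \<ge> 0"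
    and le: "\<And>y. l1norm (y - x) \<le> length js * n \<Longrightarrow> \<bar>f y\<bar> \<le> M"
    and eq: "\<And>y. l1norm (y - x) \<le> length js * n \<Longrightarrow> lap f y = - \<kappa> * f y"
  shows "\<bar>D_iter js f x\<bar> \<le> ((real CARD('d) * (real CARD('d) + 1) + \<kappa> * n\<^sup>2 / 2) / n) ^ length js * M"
  using le eq
proof (induction js arbitrary: x)
  case Nil
  then show ?case by simp
next
  case (Cons j js)
  define c where "c = (real CARD('d) * (real CARD('d) + 1) + \<kappa> * n\<^sup>2 / 2) / n"
  \<comment> \<open>By induction \<open>B\<close> bounds the inner derivatives on the whole ball of
    radius \<open>n\<close> around \<open>x\<close>, so the gradient estimate contributes one more
    factor \<open>c\<close>.\<close>
  define B where "B = c ^ length js * M"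
  have "0 < real CARD('d) * (real CARD('d) + 1)" by simp
  moreover have "0 \<le> \<kappa> * n\<^sup>2 / 2" using kap by simp
  ultimately have c: "0 < c" using n unfolding c_def by (intro divide_pos_pos add_pos_nonneg) auto
  have "\<bar>D j (D_iter js f) x\<bar> \<le> real CARD('d) * (real CARD('d) + 1) * B / n + \<kappa> * B * n / 2"
  proof (rule gradient_bound)
    show "B > 0" using c M by (simp add: B_def)
    fix z
    {
      assume z: "l1norm (z - x) \<le> n"
      have "\<bar>D_iter js f z\<bar> \<le> c ^ length js * M"
        unfolding c_def
      proof (rule Cons.IH)
        fix y assume "l1norm (y - z) \<le> length js * n"
        then have "l1norm (y - x) \<le> length (j # js) * n"
          using z l1norm_triangle[of "y - z" "z - x"] by simp
        then show "\<bar>f y\<bar> \<le> M" "lap f y = - \<kappa> * f y" using Cons.prems by blast+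
      qed
      then show "\<bar>D_iter js f z\<bar> \<le> B" by (simp add: B_def)
    next
      assume z: "l1norm (z - x) < n"
      show "lap (D_iter js f) z = - \<kappa> * D_iter js f z"
      proof (rule lap_D_iter_eq)
        fix y assume "l1norm (y - z) \<le> length js"
        \<comment> \<open>The equation for \<open>D_iter js f\<close> at \<open>z\<close> reaches
          \<open>length js\<close> steps beyond \<open>z\<close>; as \<open>n \<ge> 1\<close>, this
          stays within the available radius.\<close>
        moreover have "length js \<le> length js * n" using n by simp
        moreover have "l1norm (y - x) \<le> l1norm (y - z) + l1norm (z - x)"
          using l1norm_triangle[of "y - z" "z - x"] by simp
        ultimately have "l1norm (y - x) \<le> length (j # js) * n"
          using z unfolding length_Cons mult_Suc by linarith
        then show "lap f y = - \<kappa> * f y" by (rule Cons.prems)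
      qed
    }
  qed (use n kap in auto)
  also have "\<dots> = c * B" using n by (simp add: c_def field_simps power2_eq_square)
  finally show ?case by (simp add: B_def c_def mult.assoc)
qed

section \<open>Neighbours and the geometry of \<open>Omega_N\<close>\<close>

lemma nbr_commute: "nbr x y \<longleftrightarrow> nbr y x"
  unfolding nbr_def by (simp add: l1norm_minus_commute)

text \<open>A unit step along a nonzero coordinate, against its sign, gets one closer to the origin.
  This drives both the description of neighbours and the induction on \<open>l1norm\<close>
  distance.\<close>

lemma l1norm_step_toward:
  assumes "x \<noteq> (0 :: int ^ 'd)"
  obtains i s where "s = 1 \<or> s = -1" "l1norm x = Suc (l1norm (x - axis i s))"
proof -
  obtain i where i: "x $ i \<noteq> 0" using assms by (auto simp: vec_eq_iff)
  define s where "s = sgn (x $ i)"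
  have s: "s = 1 \<or> s = -1" using i by (simp add: s_def sgn_if)
  have "(\<Sum>k\<in>UNIV - {i}. nat \<bar>(x - axis i s) $ k\<bar>) = (\<Sum>k\<in>UNIV - {i}. nat \<bar>x $ k\<bar>)"
    by (rule sum.cong) (auto simp: axis_nth_if)
  then have "l1norm x = Suc (l1norm (x - axis i s))"
    using i unfolding l1norm_eq_nth_plus[of _ i] by (auto simp: axis_nth_if s_def sgn_if)
  with s that show thesis by blast
qed

lemma nbr_iff: "nbr x y \<longleftrightarrow> (\<exists>i. y = x + axis i 1 \<or> y = x - axis i 1)"
proof
  assume a: "nbr x y"
  then have "y - x \<noteq> 0" by (auto simp: nbr_def)
  then obtain i s where s: "s = 1 \<or> s = -1" "l1norm (y - x) = Suc (l1norm (y - x - axis i s))"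
    by (rule l1norm_step_toward)
  then have "y - x = axis i s"
    using a by (simp add: nbr_def l1norm_minus_commute[of x] l1norm_eq_0)
  then have "y = x + axis i s" by (simp add: algebra_simps)
  moreover have "axis i (-1) = - axis i (1::int)" by (simp add: vec_eq_iff axis_nth_if)
  ultimately show "\<exists>i. y = x + axis i 1 \<or> y = x - axis i 1" using s by auto
qed (auto simp: nbr_def l1norm_axis)

lemma sum_nbr:
  fixes f :: "int ^ 'd \<Rightarrow> real"
  shows "(\<Sum>y | nbr x y. f y) = (\<Sum>i\<in>UNIV. f (x + axis i 1) + f (x - axis i 1))"
proof -
  have "{y. nbr x y} = range (\<lambda>i. x + axis i 1) \<union> range (\<lambda>i. x - axis i 1)"
    by (auto simp: nbr_iff)
  moreover have "range (\<lambda>i. x + axis i 1) \<inter> range (\<lambda>i. x - axis i 1) = {}"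
  proof (rule ccontr)
    assume "range (\<lambda>i. x + axis i 1) \<inter> range (\<lambda>i. x - axis i 1) \<noteq> {}"
    then obtain i k where "x + axis i 1 = x - axis k 1" by blast
    from arg_cong[OF this, of "\<lambda>v. v $ i"] show False by (auto simp: axis_nth_if split: if_splits)
  qed
  moreover have "inj (\<lambda>i. x + axis i 1)" "inj (\<lambda>i. x - axis i 1)"
    by (auto simp: inj_def axis_eq_axis)
  ultimately show ?thesis
    by (simp add: sum.union_disjoint sum.reindex sum.distrib)
qed

lemma finite_Omega_N:
  assumes "bounded \<Omega>" shows "finite (Omega_N (\<Omega> :: (real ^ 'd) set) N)"
proof -
  have "bounded ((\<lambda>v. real N *\<^sub>R v) ` \<Omega>)" using assms by (rule bounded_scaling)
  then obtain B where B: "\<And>v. v \<in> (\<lambda>v. real N *\<^sub>R v) ` \<Omega> \<Longrightarrow> norm v \<le> B"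
    unfolding bounded_iff by blast
  have "Omega_N \<Omega> N \<subseteq> {x. \<forall>i. x $ i \<in> {- \<lceil>B\<rceil>..\<lceil>B\<rceil>}}"
  proof safe
    fix x i assume "x \<in> Omega_N \<Omega> N"
    then have "norm (lat x) \<le> B" by (intro B) (simp add: Omega_N_def scaled_lattice_def)
    with component_le_norm_cart[of "lat x" i] have "\<bar>real_of_int (x $ i)\<bar> \<le> B"
      by (simp add: lat_def)
    then show "x $ i \<in> {- \<lceil>B\<rceil>..\<lceil>B\<rceil>}" by simp linarith
  qed
  then show ?thesis by (rule finite_subset) (rule finite_int_vec_box, simp)
qed

text \<open>Induction on the distance to \<open>x\<close>: the point one step closer lies in
  \<open>Omega_N\<close>, so if \<open>y\<close> did not, it would be a boundary point strictly
  closer than \<open>graph_dist\<close>.\<close>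

lemma l1_ball_subset_Omega_N:
  assumes "x \<in> Omega_N \<Omega> N" "l1norm (y - x) < graph_dist x (bdry_N \<Omega> N)"
  shows "y \<in> Omega_N \<Omega> N"
  using assms(2)
proof (induction "l1norm (y - x)" arbitrary: y)
  case 0
  then show ?case using assms(1) l1norm_eq_0[of "y - x"] by simp
next
  case (Suc m)
  then have "y - x \<noteq> 0" by auto
  then obtain i s where s: "s = 1 \<or> s = -1" "l1norm (y - x) = Suc (l1norm (y - x - axis i s))"
    by (rule l1norm_step_toward)
  have e: "y - axis i s - x = y - x - axis i s" by (simp add: algebra_simps)
  have y: "y - axis i s \<in> Omega_N \<Omega> N"
    by (rule Suc.hyps(1); unfold e) (use s(2) Suc.hyps(2) Suc.prems in linarith)+
  have nb: "nbr (y - axis i s) y" using s(1) by (auto simp: nbr_def l1norm_axis)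
  show ?case
  proof (rule ccontr)
    assume "y \<notin> Omega_N \<Omega> N"
    with y nb have "y \<in> bdry_N \<Omega> N" by (auto simp: bdry_N_def)
    then have "graph_dist x (bdry_N \<Omega> N) \<le> l1norm (x - y)"
      unfolding graph_dist_def by (intro cINF_lower) auto
    with Suc.prems show False by (simp add: l1norm_minus_commute)
  qed
qed

section \<open>The eigenvalue equation and comparison of eigenvalues\<close>

lemma sum_P_N:
  fixes f :: "int ^ 'd \<Rightarrow> real"
  assumes fin: "finite (Omega_N \<Omega> N)" and x: "x \<in> Omega_N \<Omega> N"
    and f0: "\<And>y. y \<notin> Omega_N \<Omega> N \<Longrightarrow> f y = 0"
  shows "(\<Sum>y\<in>Omega_N \<Omega> N. P_N \<Omega> N x y * f y)
    = (\<Sum>i\<in>UNIV. f (x + axis i 1) + f (x - axis i 1)) / (2 * real CARD('d))"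
proof -
  have fn: "finite {y. nbr x y}"
  proof -
    have "{y. nbr x y} = range (\<lambda>i. x + axis i 1) \<union> range (\<lambda>i. x - axis i 1)"
      by (auto simp: nbr_iff)
    then show ?thesis by simp
  qed
  have "(\<Sum>y\<in>Omega_N \<Omega> N. P_N \<Omega> N x y * f y)
      = (\<Sum>y\<in>Omega_N \<Omega> N. if nbr x y then f y / (2 * real CARD('d)) else 0)"
    by (rule sum.cong) (auto simp: P_N_def x)
  also have "\<dots> = (\<Sum>y\<in>Omega_N \<Omega> N \<inter> {y. nbr x y}. f y / (2 * real CARD('d)))"
    using fin by (simp add: sum.inter_restrict)
  \<comment> \<open>Extension by zero lets the sum run over all neighbours, including those outside
    \<open>Omega_N\<close>.\<close>
  also have "\<dots> = (\<Sum>y | nbr x y. f y / (2 * real CARD('d)))"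
    using fn f0 by (intro sum.mono_neutral_left) auto
  finally show ?thesis by (simp add: sum_divide_distrib[symmetric] sum_nbr)
qed

text \<open>The neighbour sum equals \<open>2 d l f x\<close>, and \<open>lap\<close> subtracts
  \<open>2 d f x\<close>; this is the source of \<open>\<kappa> = 2 d (1 - l)\<close>.\<close>

lemma eigenvector_lap:
  fixes f :: "int ^ 'd \<Rightarrow> real"
  assumes fin: "finite (Omega_N \<Omega> N)" and x: "x \<in> Omega_N \<Omega> N"
    and f0: "\<And>y. y \<notin> Omega_N \<Omega> N \<Longrightarrow> f y = 0"
    and ev: "eigenvector_P_N \<Omega> N l f"
  shows "lap f x = - (2 * real CARD('d) * (1 - l)) * f x"
proof -
  have "(\<Sum>y\<in>Omega_N \<Omega> N. P_N \<Omega> N x y * f y)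
      = (\<Sum>i\<in>UNIV. f (x + axis i 1) + f (x - axis i 1)) / (2 * real CARD('d))"
    by (rule sum_P_N) (use fin x f0 in auto)
  then have "(\<Sum>i\<in>UNIV. f (x + axis i 1) + f (x - axis i 1)) / (2 * real CARD('d)) = l * f x"
    using ev x by (simp add: eigenvector_P_N_def)
  then have "(\<Sum>i\<in>UNIV. f (x + axis i 1) + f (x - axis i 1)) = l * f x * (2 * real CARD('d))"
    by (simp add: field_simps)
  moreover have "lap f x = (\<Sum>i\<in>UNIV. f (x + axis i 1) + f (x - axis i 1)) - 2 * real CARD('d) * f x"
    by (simp add: lap_def sum_subtractf)
  ultimately show ?thesis by (simp add: algebra_simps)
qed

text \<open>At a maximum point of \<open>f\<close>, which is global because \<open>f\<close>
  vanishes outside \<open>Omega_N\<close>, one has \<open>lap f \<le> 0\<close>. This gives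
  \<open>\<kappa> \<ge> 0\<close>.\<close>

lemma positive_eigenvalue_le_1:
  fixes f :: "int ^ 'd \<Rightarrow> real"
  assumes fin: "finite (Omega_N \<Omega> N)" and ne: "Omega_N \<Omega> N \<noteq> {}"
    and f0: "\<And>y. y \<notin> Omega_N \<Omega> N \<Longrightarrow> f y = 0"
    and pos: "\<And>y. y \<in> Omega_N \<Omega> N \<Longrightarrow> f y > 0"
    and ev: "eigenvector_P_N \<Omega> N l f"
  shows "l \<le> 1"
proof -
  have "finite (f ` Omega_N \<Omega> N)" "f ` Omega_N \<Omega> N \<noteq> {}" using fin ne by auto
  from Max_in[OF this] Max_ge[OF this(1)] obtain y where y: "y \<in> Omega_N \<Omega> N"
    and "\<And>z. z \<in> Omega_N \<Omega> N \<Longrightarrow> f z \<le> f y" by fastforce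
  then have mx: "f z \<le> f y" for z using pos[OF y] f0[of z] by fastforce
  have "lap f y \<le> 0" unfolding lap_def
  proof (rule sum_nonpos)
    fix i show "f (y + axis i 1) + f (y - axis i 1) - 2 * f y \<le> 0"
      using mx[of "y + axis i 1"] mx[of "y - axis i 1"] by linarith
  qed
  then have "0 \<le> 2 * real CARD('d) * (1 - l) * f y"
    using eigenvector_lap[OF fin y f0 ev] by simp
  then show ?thesis using pos[OF y] by (simp add: zero_le_mult_iff)
qed

text \<open>Testing the eigenvalue equation against a nonnegative subsolution \<open>g\<close>; positivity of the
  eigenfunction makes the comparison of eigenvalues immediate.\<close>

lemma eigenvalue_ge_of_subsolution:
  fixes f g :: "int ^ 'd \<Rightarrow> real"
  assumes fin: "finite (Omega_N \<Omega> N)"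
    and f0: "\<And>y. y \<notin> Omega_N \<Omega> N \<Longrightarrow> f y = 0"
    and pos: "\<And>y. y \<in> Omega_N \<Omega> N \<Longrightarrow> f y > 0"
    and ev: "eigenvector_P_N \<Omega> N l f"
    and g0: "\<And>y. y \<notin> Omega_N \<Omega> N \<Longrightarrow> g y = 0" and gn: "\<And>y. g y \<ge> 0"
    and x: "x \<in> Omega_N \<Omega> N" "g x > 0"
    and sub: "\<And>y. 2 * real CARD('d) * \<mu> * g y \<le> (\<Sum>i\<in>UNIV. g (y + axis i 1) + g (y - axis i 1))"
  shows "\<mu> \<le> l"
proof -
  let ?O = "Omega_N \<Omega> N"
  have P: "P_N \<Omega> N y z = P_N \<Omega> N z y" for y z by (simp add: P_N_def nbr_commute[of y] conj_commute)
  have "\<mu> * (\<Sum>y\<in>?O. f y * g y) = (\<Sum>y\<in>?O. f y * (\<mu> * g y))"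
    by (simp add: sum_distrib_left algebra_simps)
  also have "\<dots> \<le> (\<Sum>y\<in>?O. f y * (\<Sum>z\<in>?O. P_N \<Omega> N y z * g z))"
  proof (intro sum_mono mult_left_mono)
    fix y assume y: "y \<in> ?O"
    have Pg: "(\<Sum>z\<in>?O. P_N \<Omega> N y z * g z)
        = (\<Sum>i\<in>UNIV. g (y + axis i 1) + g (y - axis i 1)) / (2 * real CARD('d))"
      by (rule sum_P_N) (use fin y g0 in auto)
    show "\<mu> * g y \<le> (\<Sum>z\<in>?O. P_N \<Omega> N y z * g z)"
      unfolding Pg using sub[of y] by (simp add: field_simps)
  qed (use pos less_imp_le in blast)
  also have "\<dots> = (\<Sum>y\<in>?O. \<Sum>z\<in>?O. f y * (P_N \<Omega> N y z * g z))"
    by (simp add: sum_distrib_left)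
  also have "\<dots> = (\<Sum>z\<in>?O. \<Sum>y\<in>?O. f y * (P_N \<Omega> N y z * g z))"
    by (rule sum.swap)
  \<comment> \<open>Symmetry of \<open>P_N\<close> moves the operator from \<open>g\<close> onto the
    eigenfunction \<open>f\<close>.\<close>
  also have "\<dots> = (\<Sum>z\<in>?O. g z * (\<Sum>y\<in>?O. P_N \<Omega> N z y * f y))"
    by (simp add: sum_distrib_left P[of _ _] algebra_simps)
  also have "\<dots> = (\<Sum>z\<in>?O. g z * (l * f z))"
    using ev by (intro sum.cong) (auto simp: eigenvector_P_N_def)
  also have "\<dots> = l * (\<Sum>y\<in>?O. f y * g y)"
    by (simp add: sum_distrib_left algebra_simps)
  finally have "\<mu> * (\<Sum>y\<in>?O. f y * g y) \<le> l * (\<Sum>y\<in>?O. f y * g y)" .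
  moreover have "0 < (\<Sum>y\<in>?O. f y * g y)"
    using fin x pos gn by (intro sum_pos2[of _ x]) (auto intro: mult_nonneg_nonneg less_imp_le)
  ultimately show ?thesis by simp
qed

section \<open>Lower bound on the eigenvalue from a cube inside \<open>Omega_N\<close>\<close>

lemma prod_cos_axis:
  fixes y :: "int ^ 'd"
  shows "(\<Prod>k\<in>UNIV. cos (t * real_of_int ((y + axis i 1) $ k)))
       + (\<Prod>k\<in>UNIV. cos (t * real_of_int ((y - axis i 1) $ k)))
       = 2 * cos t * (\<Prod>k\<in>UNIV. cos (t * real_of_int (y $ k)))"
proof -
  let ?R = "\<Prod>k\<in>UNIV - {i}. cos (t * real_of_int (y $ k))"
  have rem: "(\<Prod>k\<in>UNIV. h k) = h i * (\<Prod>k\<in>UNIV - {i}. h k)" for h :: "'d \<Rightarrow> real"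
    by (rule prod.remove) auto
  have "(\<Prod>k\<in>UNIV - {i}. cos (t * real_of_int ((y + axis i 1) $ k))) = ?R"
    "(\<Prod>k\<in>UNIV - {i}. cos (t * real_of_int ((y - axis i 1) $ k))) = ?R"
    by (rule prod.cong; auto simp: axis_nth_if)+
  \<comment> \<open>Only the factor \<open>i\<close> changes, and
    \<open>cos (a + t) + cos (a - t) = 2 * cos t * cos a\<close>.\<close>
  then show ?thesis
    unfolding rem by (simp add: axis_nth_if algebra_simps cos_add cos_diff)
qed

text \<open>The comparison function is the principal eigenfunction of a cube contained in the
  \<open>l\<^sup>1\<close>-ball of radius \<open>graph_dist x (bdry_N \<Omega> N)\<close> around \<open>x\<close>.\<close>

lemma eigenvalue_ge_cos:
  fixes f :: "int ^ 'd \<Rightarrow> real"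
  assumes fin: "finite (Omega_N \<Omega> N)"
    and f0: "\<And>y. y \<notin> Omega_N \<Omega> N \<Longrightarrow> f y = 0"
    and pos: "\<And>y. y \<in> Omega_N \<Omega> N \<Longrightarrow> f y > 0"
    and ev: "eigenvector_P_N \<Omega> N l f"
    and x: "x \<in> Omega_N \<Omega> N" and m: "CARD('d) * m < graph_dist x (bdry_N \<Omega> N)"
  shows "cos (pi / (2 * (real m + 1))) \<le> l"
proof -
  \<comment> \<open>With this frequency the cosines are positive on \<open>{-m..m}\<close> and
    vanish at \<open>m + 1\<close> and \<open>- (m + 1)\<close>.\<close>
  define t where "t = pi / (2 * (real m + 1))"
  define c where "c y = (\<Prod>k\<in>UNIV. cos (t * real_of_int (y $ k)))" for y :: "int ^ 'd"
  define box where "box = {y :: int ^ 'd. \<forall>k. \<bar>y $ k\<bar> \<le> int m}"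
  define g where "g y = (if y - x \<in> box then c (y - x) else 0)" for y
  have t: "t > 0" by (simp add: t_def)
  have tm: "t * (real m + 1) = pi / 2"
    using of_nat_0_le_iff[of m] by (simp add: t_def divide_simps)
  have cpos: "cos (t * real_of_int s) > 0" if "\<bar>s\<bar> \<le> int m" for s
  proof -
    have "t * \<bar>real_of_int s\<bar> < t * (real m + 1)"
      using that t by (intro mult_strict_left_mono) linarith+
    then have "\<bar>t * real_of_int s\<bar> < pi / 2" using t tm by (simp add: abs_mult)
    then show ?thesis by (intro cos_gt_zero_pi) auto
  qed
  have cbox: "c y > 0" if "y \<in> box" for y
    unfolding c_def using that cpos by (intro prod_pos) (auto simp: box_def)
  have gn: "g y \<ge> 0" for y using cbox by (simp add: g_def less_imp_le)
  \<comment> \<open>Cutting \<open>c\<close> off outside the cube does not alter its values at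
    neighbours of the cube: a point one step outside has a coordinate of modulus
    \<open>m + 1\<close>, where the cosine is zero.\<close>
  have ceq: "(if y + axis i s \<in> box then c (y + axis i s) else 0) = c (y + axis i s)"
    if y: "y \<in> box" and s: "s = 1 \<or> s = -1" for y i s
  proof (cases "y + axis i s \<in> box")
    case False
    then obtain k where "\<bar>(y + axis i s) $ k\<bar> > int m" by (auto simp: box_def not_le)
    moreover have "\<bar>y $ k\<bar> \<le> int m" using y by (auto simp: box_def)
    ultimately have "\<bar>(y + axis i s) $ k\<bar> = int m + 1"
      using s by (auto simp: axis_nth_if split: if_splits)
    then have "\<bar>real_of_int ((y + axis i s) $ k)\<bar> = real m + 1" by linarith
    then have "\<bar>t * real_of_int ((y + axis i s) $ k)\<bar> = pi / 2"
      using t tm by (simp add: abs_mult)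
    then have "cos (t * real_of_int ((y + axis i s) $ k)) = 0"
      by (metis cos_abs_real cos_pi_half)
    then have "c (y + axis i s) = 0" unfolding c_def by (intro prod_zero) auto
    then show ?thesis by simp
  qed simp
  have "cos t \<le> l"
  proof (rule eigenvalue_ge_of_subsolution[OF fin f0 pos ev])
    show "g y = 0" if "y \<notin> Omega_N \<Omega> N" for y
    proof -
      have "y - x \<notin> box"
      proof
        assume "y - x \<in> box"
        then have "l1norm (y - x) \<le> (\<Sum>i\<in>(UNIV :: 'd set). m)"
          unfolding l1norm_def box_def by (intro sum_mono) (auto simp: nat_le_iff)
        with m have "l1norm (y - x) < graph_dist x (bdry_N \<Omega> N)" by simp
        with l1_ball_subset_Omega_N[OF x] that show False by blast
      qed
      then show ?thesis by (simp add: g_def)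
    qed
    show "g x > 0" by (simp add: g_def cbox box_def c_def)
    fix y
    show "2 * real CARD('d) * cos t * g y \<le> (\<Sum>i\<in>UNIV. g (y + axis i 1) + g (y - axis i 1))"
    proof (cases "y - x \<in> box")
      case True
      \<comment> \<open>Inside the cube \<open>g\<close> satisfies the eigenvalue relation exactly,
        direction by direction; outside, \<open>g y = 0\<close> and the right-hand side is
        nonnegative.\<close>
      have "g (y + axis i 1) + g (y - axis i 1) = 2 * cos t * g y" for i
      proof -
        have m1: "axis i (-1) = - axis i (1::int)" by (simp add: vec_eq_iff axis_nth_if)
        have e: "y + axis i 1 - x = y - x + axis i 1" "y - axis i 1 - x = y - x - axis i 1"
          by (simp_all add: algebra_simps)
        have "g (y + axis i 1) = c (y - x + axis i 1)"
          using ceq[OF True, of 1 i] by (simp add: g_def e split: if_splits)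
        moreover have "g (y - axis i 1) = c (y - x - axis i 1)"
          using ceq[OF True, of "-1" i] by (simp add: g_def e m1 split: if_splits)
        moreover have "g y = c (y - x)" using True by (simp add: g_def)
        ultimately show ?thesis unfolding c_def by (simp only: prod_cos_axis)
      qed
      then show ?thesis by simp
    next
      case False
      then show ?thesis using gn by (simp add: g_def sum_nonneg)
    qed
  qed (use x gn in auto)
  then show ?thesis by (simp add: t_def)
qed

text \<open>The largest admissible cube has \<open>d (m + 1) \<ge> 2 n\<close>, so its frequency
  satisfies \<open>t n \<le> d\<close>, and \<open>1 - cos t \<le> t^2\<close>.\<close>

lemma one_minus_eigenvalue_le:
  fixes f :: "int ^ 'd \<Rightarrow> real"
  assumes fin: "finite (Omega_N \<Omega> N)"
    and f0: "\<And>y. y \<notin> Omega_N \<Omega> N \<Longrightarrow> f y = 0"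
    and pos: "\<And>y. y \<in> Omega_N \<Omega> N \<Longrightarrow> f y > 0"
    and ev: "eigenvector_P_N \<Omega> N l f"
    and x: "x \<in> Omega_N \<Omega> N" and n: "0 < n" "2 * n \<le> graph_dist x (bdry_N \<Omega> N)"
  shows "(1 - l) * (real n)\<^sup>2 \<le> (real CARD('d))\<^sup>2"
proof -
  let ?r = "graph_dist x (bdry_N \<Omega> N)" and ?d = "real CARD('d)"
  \<comment> \<open>The largest \<open>m\<close> with \<open>d m < ?r\<close>; subtracting 1
    accounts for the strict inequality.\<close>
  define m where "m = (?r - 1) div CARD('d)"
  define t where "t = pi / (2 * (real m + 1))"
  have "CARD('d) * m \<le> ?r - 1" by (simp add: m_def)
  then have m: "CARD('d) * m < ?r" using n by linarith
  have l: "cos t \<le> l"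
    unfolding t_def by (rule eigenvalue_ge_cos[OF fin f0 pos ev x m])
  have "?r - 1 < CARD('d) * (m + 1)"
    unfolding m_def by (metis Suc_eq_plus1 dividend_less_times_div mult_Suc_right add.commute zero_less_card_finite)
  then have "2 * n \<le> CARD('d) * (m + 1)" using n by linarith
  then have "real (2 * n) \<le> real (CARD('d) * (m + 1))" by (simp only: of_nat_le_iff)
  then have nm: "2 * real n \<le> ?d * (real m + 1)" by (simp add: algebra_simps)
  have "t * n = pi / 4 * (2 * n) / (real m + 1)" by (simp add: t_def field_simps)
  also have "\<dots> \<le> pi / 4 * (?d * (real m + 1)) / (real m + 1)"
    using nm by (intro divide_right_mono mult_left_mono) auto
  also have "\<dots> = pi / 4 * ?d"
    using of_nat_0_le_iff[of m] by (simp add: divide_simps)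
  also have "\<dots> \<le> 1 * ?d" using pi_less_4 by (intro mult_right_mono) auto
  finally have tn: "t * n \<le> ?d" by simp
  have "t \<ge> 0" by (simp add: t_def)
  have "1 - t\<^sup>2 / 2 \<le> cos t"
  proof -
    have "cos t = 1 - 2 * (sin (t / 2))\<^sup>2" using cos_double_sin[of "t / 2"] by simp
    moreover have "(sin (t / 2))\<^sup>2 \<le> (t / 2)\<^sup>2"
      using abs_sin_x_le_abs_x[of "t / 2"] by (simp only: abs_le_square_iff)
    ultimately show ?thesis by (simp add: power_divide)
  qed
  with l have "1 - l \<le> t\<^sup>2" using zero_le_power2[of t] by linarith
  then have "(1 - l) * (real n)\<^sup>2 \<le> (t * n)\<^sup>2" by (simp add: power_mult_distrib mult_right_mono)
  also have "\<dots> \<le> ?d\<^sup>2" using tn \<open>t \<ge> 0\<close> by (intro power_mono) auto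
  finally show ?thesis .
qed

section \<open>The derivative bound: choice of the constant and of the step length\<close>

theorem theorem2p11:
  fixes \<Omega> :: "(real ^ 'd) set"
  assumes "CARD('d) \<ge> 2"
    and "open \<Omega>" and "bounded \<Omega>" and "connected \<Omega>" and "0 \<in> \<Omega>"
  shows "\<exists>C::real. C > 0 \<and>
    (\<forall>(N::nat) (\<phi> :: int ^ 'd \<Rightarrow> real) (k::nat) (js :: 'd list) (x :: int ^ 'd) (R::real).
       N \<ge> 1 \<longrightarrow> principal_eigenfunction \<Omega> N \<phi> \<longrightarrow>
       k \<ge> 1 \<longrightarrow> length js = k \<longrightarrow>
       x \<in> Omega_N \<Omega> N \<longrightarrow> graph_dist x (bdry_N \<Omega> N) \<ge> 4 * k \<longrightarrow>
       2 * real k \<le> R \<longrightarrow> R \<le> real (graph_dist x (bdry_N \<Omega> N)) / 2 \<longrightarrow>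
       \<bar>D_iter js \<phi> x\<bar> \<le> (C * real k / R) ^ k * (SUP w\<in>discrete_ball x R. \<bar>\<phi> w\<bar>))"
proof -
  let ?d = "real CARD('d)"
  \<comment> \<open>\<open>d (d + 1)\<close> comes from the gradient estimate and
    \<open>d ^ 3\<close> bounds \<open>\<kappa> n^2 / 2\<close>. The final constant is
    \<open>2 * c\<close>, the 2 paying for rounding \<open>R / k\<close> down.\<close>
  define c where "c = ?d * (?d + 1) + ?d ^ 3"
  have c: "c > 0" unfolding c_def by (intro add_pos_pos) auto
  show ?thesis
  proof (intro exI[of _ "2 * c"] conjI allI impI)
    show "2 * c > 0" using c by simp
    fix N :: nat and \<phi> :: "int ^ 'd \<Rightarrow> real" and k and js :: "'d list" and x :: "int ^ 'd" and R :: real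
    let ?r = "graph_dist x (bdry_N \<Omega> N)"
    assume pe: "principal_eigenfunction \<Omega> N \<phi>" and k: "k \<ge> 1" and js: "length js = k"
      and x: "x \<in> Omega_N \<Omega> N" and R: "2 * real k \<le> R" "R \<le> real ?r / 2"
    obtain l where ev: "eigenvector_P_N \<Omega> N l \<phi>"
      using pe by (auto simp: principal_eigenfunction_def)
    have pos: "\<phi> y > 0" if "y \<in> Omega_N \<Omega> N" for y
      using pe that by (auto simp: principal_eigenfunction_def)
    have zero: "\<phi> y = 0" if "y \<notin> Omega_N \<Omega> N" for y
      using pe that by (auto simp: principal_eigenfunction_def)
    have fin: "finite (Omega_N \<Omega> N)" by (rule finite_Omega_N) fact
    define M where "M = (SUP w\<in>discrete_ball x R. \<bar>\<phi> w\<bar>)"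
    \<comment> \<open>\<open>\<phi>\<close> takes finitely many values, so the supremum is a genuine
      upper bound.\<close>
    have "range (\<lambda>w. \<bar>\<phi> w\<bar>) \<subseteq> insert 0 ((\<lambda>w. \<bar>\<phi> w\<bar>) ` Omega_N \<Omega> N)"
      using zero by fastforce
    then have "finite (range (\<lambda>w. \<bar>\<phi> w\<bar>))" using fin finite_subset by blast
    then have "bdd_above ((\<lambda>w. \<bar>\<phi> w\<bar>) ` discrete_ball x R)"
      by (intro bdd_above_finite) (rule finite_subset[rotated], auto)
    then have le: "\<bar>\<phi> w\<bar> \<le> M" if "w \<in> discrete_ball x R" for w
      unfolding M_def using that by (intro cSUP_upper)
    \<comment> \<open>Since \<open>R / k \<ge> 2\<close>, rounding down keeps
      \<open>n \<ge> 1\<close> and loses at most a factor 2.\<close>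
    define n where "n = nat \<lfloor>R / k\<rfloor>"
    have Rk: "2 \<le> R / k" using R k by (simp add: field_simps)
    then have n: "1 \<le> n" "real n \<le> R / k" "R / k \<le> 2 * n"
      unfolding n_def by (simp_all add: le_nat_floor) linarith+
    then have kn: "real (k * n) \<le> R" using k by (simp add: field_simps)
    have "n \<le> k * n" using k by simp
    then have "real n \<le> real (k * n)" by (simp only: of_nat_le_iff)
    with kn have "real n \<le> R" by linarith
    then have nr: "2 * n \<le> ?r" using R by linarith
    have R0: "R > 0" using R k by linarith
    have knr: "k * n < ?r"
    proof -
      have "real (k * n) < real ?r" using kn R R0 by linarith
      then show ?thesis by (simp only: of_nat_less_iff)
    qed
    \<comment> \<open>All \<open>k\<close> steps together stay in an \<open>l1norm\<close> ball of
      radius \<open>k * n \<le> R < ?r\<close>, which lies both in the Euclidean ball and in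
      \<open>Omega_N\<close>.\<close>
    have ball: "y \<in> discrete_ball x R" "y \<in> Omega_N \<Omega> N" if "l1norm (y - x) \<le> k * n" for y
    proof -
      have "norm (lat (y - x)) \<le> real (l1norm (y - x))" by (rule norm_lat_le_l1norm)
      also have "\<dots> \<le> real (k * n)" using that by (simp only: of_nat_le_iff)
      finally show "y \<in> discrete_ball x R" using kn by (simp add: discrete_ball_def)
      show "y \<in> Omega_N \<Omega> N" using that knr by (intro l1_ball_subset_Omega_N[OF x]) simp
    qed
    have M: "M > 0" using le[of x] ball[of x] pos[OF x] by simp
    define \<kappa> where "\<kappa> = 2 * ?d * (1 - l)"
    have "l \<le> 1" by (rule positive_eigenvalue_le_1) (use fin zero pos ev x in auto)
    then have kap: "\<kappa> \<ge> 0" by (simp add: \<kappa>_def)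
    have "\<kappa> * n\<^sup>2 / 2 = ?d * ((1 - l) * (real n)\<^sup>2)" by (simp add: \<kappa>_def)
    also have "\<dots> \<le> ?d * ?d\<^sup>2"
      using one_minus_eigenvalue_le[OF fin zero pos ev x _ nr] n by (intro mult_left_mono) auto
    also have "\<dots> = ?d ^ 3" by (simp add: power2_eq_square power3_eq_cube)
    finally have kc: "?d * (?d + 1) + \<kappa> * n\<^sup>2 / 2 \<le> c" by (simp add: c_def)
    have "\<bar>D_iter js \<phi> x\<bar> \<le> ((?d * (?d + 1) + \<kappa> * n\<^sup>2 / 2) / n) ^ length js * M"
      by (rule D_iter_bound)
        (use n M kap js ball le eigenvector_lap[OF fin _ zero ev] in \<open>auto simp: \<kappa>_def\<close>)
    also have "\<dots> \<le> (2 * c * k / R) ^ k * M"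
      unfolding js
    proof (intro mult_right_mono power_mono)
      have "(?d * (?d + 1) + \<kappa> * n\<^sup>2 / 2) / n \<le> c / n"
        using kc by (intro divide_right_mono) auto
      also have "\<dots> \<le> 2 * c * k / R"
        using n k R0 c by (simp add: field_simps)
      finally show "(?d * (?d + 1) + \<kappa> * n\<^sup>2 / 2) / n \<le> 2 * c * k / R" .
    qed (use M kap in auto)
    finally show "\<bar>D_iter js \<phi> x\<bar> \<le> (2 * c * real k / R) ^ k * (SUP w\<in>discrete_ball x R. \<bar>\<phi> w\<bar>)"
      by (simp add: M_def)
  qed
qed

end
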